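(* Let $X$ be a set, $\Lambda$ a uniform Banach space, $\mathcal{B}$ a $\Lambda$-valued RKBS on $X$ with reproducing kernel $K$, $m\in\mathbb{N}$, $x_1,\dots,x_m\in X$, $\xi_1,\dots,\xi_m\in\Lambda$ and $\lambda>0$. Suppose that the point evaluations on $\mathcal{B}$ at $x_1,\dots,x_m$ are essentially linearly independent. Then $f_0\in\mathcal{B}$ is the minimizer of the regularization network $$\min_{f\in\mathcal{B}}\sum_{j=1}^m\|f(x_j)-\xi_j\|_\Lambda^2+\lambda\|f\|_{\mathcal{B}}^2$$ if and only if it is of the form $$f_0^*=\sum_{j=1}^m(K(x_j,\cdot)\eta_j)^*$$ for some $\eta_1,\dots,\eta_m\in\Lambda$ satisfying $$\lambda\eta_j+f_0(x_j)-\xi_j=0\quad\text{for all }j\in\{1,\dots,m\}.$$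
   Context: Banach spaces are over $\mathbb{C}$. A semi-inner product on a Banach space $V$ is a function $[\cdot,\cdot]_V:V\times V\to\mathbb{C}$ that is linear in its first variable, conjugate homogeneous in its second ($[f,\alpha g]_V=\overline{\alpha}[f,g]_V$), positive ($[f,f]_V>0$ for $f\neq0$), and satisfies $|[f,g]_V|\le[f,f]_V^{1/2}[g,g]_V^{1/2}$. It is compatible if $[f,f]_V^{1/2}=\|f\|_V$ for all $f\in V$. $V$ is uniformly convex if for all $\varepsilon>0$ there is $\delta>0$ with $\|f+g\|_V\le2-\delta$ whenever $\|f\|_V=\|g\|_V=1$ and $\|f-g\|_V\ge\varepsilon$. $V$ is uniformly Fréchet differentiable if $\lim_{t\in\mathbb{R},t\to0}(\|f+tg\|_V-\|f\|_V)/t$ exists uniformly over $f,g$ in the unit sphere of $V$. $V$ is called uniform if it is both uniformly convex and uniformly Fréchet differentiable. A uniform Banach space $V$ has a unique compatible semi-inner product, always denoted $[\cdot,\cdot]_V$; for $f\in V$, $f^*\in V^*$ denotes the functional $f^*(g)=[g,f]_V$, and $f\mapsto f^*$ is a bijective isometry from $V$ to $V^*$ (Giles). A $\Lambda$-valued RKBS on $X$ is a Banach space $\mathcal{B}$ consisting of functions from $X$ to $\Lambda$, with both $\mathcal{B}$ and $\Lambda$ uniform, such that $\|f\|_{\mathcal{B}}=0$ iff $f(x)=0$ for all $x\in X$, and such that for every $x\in X$ the point evaluation $f\mapsto f(x)$ is continuous from $\mathcal{B}$ to $\Lambda$. $\mathcal{M}(\Lambda)$ is the set of all (not necessarily linear)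 maps $T:\Lambda\to\Lambda$ for which there is $\alpha\ge0$ with $\|Tu\|_\Lambda\le\alpha\|u\|_\Lambda$ for all $u$. The reproducing kernel of $\mathcal{B}$ is the unique function $K:X\times X\to\mathcal{M}(\Lambda)$ such that $K(x,\cdot)\xi\in\mathcal{B}$ and $[f(x),\xi]_\Lambda=[f,K(x,\cdot)\xi]_{\mathcal{B}}$ for all $f\in\mathcal{B}$, $x\in X$, $\xi\in\Lambda$, where $K(x,\cdot)\xi$ denotes the function $y\mapsto K(x,y)\xi$. The point evaluations on $\mathcal{B}$ at $x_1,\dots,x_m$ are essentially linearly independent if, for all $\eta_1,\dots,\eta_m\in\Lambda$, the condition $\sum_{j=1}^m[f(x_j),\eta_j]_\Lambda=0$ for all $f\in\mathcal{B}$ implies $\eta_j=0$ for each $j$. *)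

theory Defs
  imports "HOL-Analysis.Analysis" "HOL-Library.Function_Algebras"
begin

class complex_vector = ab_group_add +
  fixes scaleC :: "complex \<Rightarrow> 'a \<Rightarrow> 'a"  (infixr "*\<^sub>C" 75)
  assumes scaleC_add_right: "a *\<^sub>C (x + y) = a *\<^sub>C x + a *\<^sub>C y"
    and scaleC_add_left: "(a + b) *\<^sub>C x = a *\<^sub>C x + b *\<^sub>C x"
    and scaleC_scaleC: "a *\<^sub>C b *\<^sub>C x = (a * b) *\<^sub>C x"
    and scaleC_one: "1 *\<^sub>C x = x"

lemma vector_space_scaleC: "vector_space (scaleC :: complex \<Rightarrow> 'a \<Rightarrow> 'a::complex_vector)"
  by unfold_locales (simp_all add: scaleC_add_right scaleC_add_left scaleC_scaleC scaleC_one)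

instantiation "fun" :: (type, complex_vector) complex_vector
begin

definition scaleC_fun :: "complex \<Rightarrow> ('a \<Rightarrow> 'b) \<Rightarrow> 'a \<Rightarrow> 'b"
  where "scaleC_fun c f = (\<lambda>x. c *\<^sub>C f x)"

instance
  by standard
    (auto simp: scaleC_fun_def fun_eq_iff scaleC_add_right scaleC_add_left scaleC_scaleC scaleC_one)

end

class complex_banach = complex_vector + banach +
  assumes scaleR_scaleC: "r *\<^sub>R x = complex_of_real r *\<^sub>C x"
    and norm_scaleC: "norm (c *\<^sub>C x) = cmod c * norm x"


text \<open>
  A space of functions carries a norm that is not the norm of a type class. The notions below are
  therefore stated for a linear subspace \<open>V\<close> of a type together with a function \<open>N\<close> that is a norm
  on \<open>V\<close>. A space that is a whole type is covered by \<open>V = UNIV\<close> and \<open>N = norm\<close>.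
\<close>

text \<open>
  The locale \<^locale>\<open>Metric_space\<close> requires a distance to be nonnegative and symmetric on the whole
  type, but \<open>N\<close> is arbitrary outside \<open>V\<close>; hence the value 0 there.
\<close>

definition norm_dist :: "'v::complex_vector set \<Rightarrow> ('v \<Rightarrow> real) \<Rightarrow> 'v \<Rightarrow> 'v \<Rightarrow> real"
  where "norm_dist V N f g = (if f \<in> V \<and> g \<in> V then N (f - g) else 0)"

definition banach_space_on :: "'v::complex_vector set \<Rightarrow> ('v \<Rightarrow> real) \<Rightarrow> bool"
  where "banach_space_on V N \<longleftrightarrow>
    module.subspace scaleC V \<and>
    (\<forall>f\<in>V. 0 \<le> N f \<and> (N f = 0 \<longleftrightarrow> f = 0)) \<and>
    (\<forall>f\<in>V. \<forall>c. N (c *\<^sub>C f) = cmod c * N f) \<and>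
    (\<forall>f\<in>V. \<forall>g\<in>V. N (f + g) \<le> N f + N g) \<and>
    Metric_space.mcomplete V (norm_dist V N)"

definition uniformly_convex_on :: "'v::complex_vector set \<Rightarrow> ('v \<Rightarrow> real) \<Rightarrow> bool"
  where "uniformly_convex_on V N \<longleftrightarrow>
    (\<forall>\<epsilon>>0. \<exists>\<delta>>0. \<forall>f\<in>V. \<forall>g\<in>V.
      N f = 1 \<longrightarrow> N g = 1 \<longrightarrow> N (f - g) \<ge> \<epsilon> \<longrightarrow> N (f + g) \<le> 2 - \<delta>)"

definition unit_sphere_on :: "'v::complex_vector set \<Rightarrow> ('v \<Rightarrow> real) \<Rightarrow> 'v set"
  where "unit_sphere_on V N = {f\<in>V. N f = 1}"

definition uniformly_frechet_on :: "'v::complex_vector set \<Rightarrow> ('v \<Rightarrow> real) \<Rightarrow> bool"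
  where "uniformly_frechet_on V N \<longleftrightarrow>
    (\<exists>D. uniform_limit (unit_sphere_on V N \<times> unit_sphere_on V N)
      (\<lambda>(t::real) (f, g). (N (f + complex_of_real t *\<^sub>C g) - N f) / t) D (at 0))"

definition uniform_banach_on :: "'v::complex_vector set \<Rightarrow> ('v \<Rightarrow> real) \<Rightarrow> bool"
  where "uniform_banach_on V N \<longleftrightarrow>
    banach_space_on V N \<and> uniformly_convex_on V N \<and> uniformly_frechet_on V N"


definition semi_inner_product_on ::
    "'v::complex_vector set \<Rightarrow> ('v \<Rightarrow> 'v \<Rightarrow> complex) \<Rightarrow> bool"
  where "semi_inner_product_on V s \<longleftrightarrow>
    (\<forall>f\<in>V. \<forall>g\<in>V. \<forall>h\<in>V. s (f + g) h = s f h + s g h) \<and>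
    (\<forall>f\<in>V. \<forall>h\<in>V. \<forall>c. s (c *\<^sub>C f) h = c * s f h) \<and>
    (\<forall>f\<in>V. \<forall>g\<in>V. \<forall>c. s f (c *\<^sub>C g) = cnj c * s f g) \<and>
    (\<forall>f\<in>V. f \<noteq> 0 \<longrightarrow> s f f \<in> \<real> \<and> Re (s f f) > 0) \<and>
    (\<forall>f\<in>V. \<forall>g\<in>V. cmod (s f g) \<le> sqrt (Re (s f f)) * sqrt (Re (s g g)))"

text \<open>
  On a uniform Banach space there is exactly one compatible semi-inner product, so fixing one with
  this predicate fixes the semi-inner product of the space; its values outside \<open>V\<close> are irrelevant.
\<close>

definition compatible_sip_on ::
    "'v::complex_vector set \<Rightarrow> ('v \<Rightarrow> real) \<Rightarrow> ('v \<Rightarrow> 'v \<Rightarrow> complex) \<Rightarrow> bool"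
  where "compatible_sip_on V N s \<longleftrightarrow>
    semi_inner_product_on V s \<and> (\<forall>f\<in>V. sqrt (Re (s f f)) = N f)"

text \<open>
  The functional \<open>f\<^sup>*\<close> on \<open>V\<close>. It is extended by 0 outside \<open>V\<close>, so that equality and sums of
  functionals on \<open>V\<close> are equality and pointwise sums of HOL functions.
\<close>

definition sip_dual ::
    "'v::complex_vector set \<Rightarrow> ('v \<Rightarrow> 'v \<Rightarrow> complex) \<Rightarrow> 'v \<Rightarrow> 'v \<Rightarrow> complex"
  where "sip_dual V s f = (\<lambda>g. if g \<in> V then s g f else 0)"


definition rkbs :: "('x \<Rightarrow> 'l::complex_banach) set \<Rightarrow> (('x \<Rightarrow> 'l) \<Rightarrow> real) \<Rightarrow> bool"
  where "rkbs B N \<longleftrightarrow>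
    uniform_banach_on (UNIV :: 'l set) norm \<and>
    uniform_banach_on B N \<and>
    (\<forall>f\<in>B. N f = 0 \<longleftrightarrow> (\<forall>x. f x = 0)) \<and>
    (\<forall>x. continuous_map (Metric_space.mtopology B (norm_dist B N)) euclidean (\<lambda>f. f x))"

definition norm_bounded_maps :: "('l::complex_banach \<Rightarrow> 'l) set"
  where "norm_bounded_maps = {T. \<exists>\<alpha>\<ge>0. \<forall>u. norm (T u) \<le> \<alpha> * norm u}"

definition reproducing_kernel ::
    "('x \<Rightarrow> 'l::complex_banach) set \<Rightarrow> (('x \<Rightarrow> 'l) \<Rightarrow> ('x \<Rightarrow> 'l) \<Rightarrow> complex) \<Rightarrow>
     ('l \<Rightarrow> 'l \<Rightarrow> complex) \<Rightarrow> ('x \<Rightarrow> 'x \<Rightarrow> 'l \<Rightarrow> 'l) \<Rightarrow> bool"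
  where "reproducing_kernel B sB sL K \<longleftrightarrow>
    (\<forall>x y. K x y \<in> norm_bounded_maps) \<and>
    (\<forall>x \<xi>. (\<lambda>y. K x y \<xi>) \<in> B) \<and>
    (\<forall>f\<in>B. \<forall>x \<xi>. sL (f x) \<xi> = sB f (\<lambda>y. K x y \<xi>))"

definition essentially_independent_evals ::
    "('x \<Rightarrow> 'l::complex_banach) set \<Rightarrow> ('l \<Rightarrow> 'l \<Rightarrow> complex) \<Rightarrow> nat \<Rightarrow> (nat \<Rightarrow> 'x) \<Rightarrow> bool"
  where "essentially_independent_evals B sL m x \<longleftrightarrow>
    (\<forall>\<eta> :: nat \<Rightarrow> 'l. (\<forall>f\<in>B. (\<Sum>j=1..m. sL (f (x j)) (\<eta> j)) = 0) \<longrightarrow> (\<forall>j\<in>{1..m}. \<eta> j = 0))"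

definition regularized_error ::
    "(('x \<Rightarrow> 'l::complex_banach) \<Rightarrow> real) \<Rightarrow> nat \<Rightarrow> (nat \<Rightarrow> 'x) \<Rightarrow> (nat \<Rightarrow> 'l) \<Rightarrow> real \<Rightarrow>
     ('x \<Rightarrow> 'l) \<Rightarrow> real"
  where "regularized_error N m x \<xi> reg f = (\<Sum>j=1..m. (norm (f (x j) - \<xi> j))\<^sup>2) + reg * (N f)\<^sup>2"

end

theory Submission
  imports Defs
begin

text \<open>
  For a compatible semi-inner product, \<open>N (f + g)\<^sup>2 \<ge> N f\<^sup>2 + 2 Re [g, f]\<close>, so \<open>Re [g, f]\<close> is a
  subgradient of \<open>N\<^sup>2 / 2\<close> at \<open>f\<close>, and differentiability of the norm makes it the derivative.
  Applied in \<open>B\<close> and in \<open>\<Lambda>\<close>, this turns minimality of \<open>f\<^sub>0\<close> into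
  \<open>reg [g, f\<^sub>0] + (\<Sum>j. [g (x j), f\<^sub>0 (x j) - \<xi> j]) = 0\<close> for all \<open>g\<close>: the real part comes from the
  direction \<open>g\<close> and the imaginary part from the direction \<open>\<i> g\<close>. By the reproducing property this
  is the asserted form of \<open>f\<^sub>0\<^sup>*\<close>, with \<open>\<eta> j\<close> determined by the second condition. Uniqueness is
  strict convexity of \<open>N\<^sup>2\<close>.
\<close>

section \<open>Normed subspaces and compatible semi-inner products\<close>

interpretation complex_vector: vector_space "scaleC :: complex \<Rightarrow> 'a \<Rightarrow> 'a::complex_vector"
  by (rule vector_space_scaleC)

lemma banach_space_onD:
  assumes "banach_space_on V N"
  shows banach_space_on_add: "f \<in> V \<Longrightarrow> g \<in> V \<Longrightarrow> f + g \<in> V"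
    and banach_space_on_scale: "f \<in> V \<Longrightarrow> c *\<^sub>C f \<in> V"
    and banach_space_on_norm_nonneg: "f \<in> V \<Longrightarrow> 0 \<le> N f"
    and banach_space_on_norm_eq_zero: "f \<in> V \<Longrightarrow> N f = 0 \<longleftrightarrow> f = 0"
    and banach_space_on_norm_scale: "f \<in> V \<Longrightarrow> N (c *\<^sub>C f) = cmod c * N f"
    and banach_space_on_norm_triangle: "f \<in> V \<Longrightarrow> g \<in> V \<Longrightarrow> N (f + g) \<le> N f + N g"
  using assms by (auto simp: banach_space_on_def complex_vector.subspace_def)

lemma banach_space_on_diff:
  assumes "banach_space_on V N" "f \<in> V" "g \<in> V"
  shows "f - g \<in> V"
  using assms complex_vector.subspace_diff[of V f g] by (simp add: banach_space_on_def)

lemma compatible_sip_onD: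
  assumes "compatible_sip_on V N s"
  shows sip_add_left: "f \<in> V \<Longrightarrow> g \<in> V \<Longrightarrow> h \<in> V \<Longrightarrow> s (f + g) h = s f h + s g h"
    and sip_scale_left: "f \<in> V \<Longrightarrow> h \<in> V \<Longrightarrow> s (c *\<^sub>C f) h = c * s f h"
    and sip_scale_right: "f \<in> V \<Longrightarrow> g \<in> V \<Longrightarrow> s f (c *\<^sub>C g) = cnj c * s f g"
    and sip_norm: "f \<in> V \<Longrightarrow> sqrt (Re (s f f)) = N f"
    and sip_Cauchy_Schwarz: "f \<in> V \<Longrightarrow> g \<in> V \<Longrightarrow> cmod (s f g) \<le> N f * N g"
  using assms by (auto simp: compatible_sip_on_def semi_inner_product_on_def)

lemma sip_self:
  assumes "banach_space_on V N" "compatible_sip_on V N s" "f \<in> V"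
  shows "Re (s f f) = (N f)\<^sup>2"
proof -
  \<comment> \<open>The real \<open>sqrt\<close> is odd, so a nonnegative value excludes a negative
    radicand. This also covers \<open>f = 0\<close>, about which positivity says nothing.\<close>
  have "0 \<le> sqrt (Re (s f f))"
    using assms by (simp add: sip_norm banach_space_on_norm_nonneg)
  then show ?thesis
    using sip_norm[OF assms(2,3)] by (metis real_sqrt_ge_0_iff real_sqrt_pow2)
qed

text \<open>Cauchy-Schwarz bounds \<open>Re (s (f + g) f)\<close> by \<open>N (f + g) * N f\<close>,
  and the arithmetic-geometric mean inequality splits this product into squares. Only linearity in
  the first variable enters.\<close>

lemma sip_subgradient:
  assumes "banach_space_on V N" "compatible_sip_on V N s" "f \<in> V" "g \<in> V"
  shows "(N f)\<^sup>2 + 2 * Re (s g f) \<le> (N (f + g))\<^sup>2"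
proof -
  have fg: "f + g \<in> V"
    using assms by (simp add: banach_space_on_add)
  have "(N f)\<^sup>2 + Re (s g f) = Re (s (f + g) f)"
    using assms by (simp add: sip_add_left sip_self)
  also have "\<dots> \<le> N (f + g) * N f"
    using sip_Cauchy_Schwarz[OF assms(2) fg assms(3)] complex_Re_le_cmod order_trans by blast
  finally have "(N f)\<^sup>2 + Re (s g f) \<le> N (f + g) * N f" .
  moreover have "2 * (N (f + g) * N f) \<le> (N (f + g))\<^sup>2 + (N f)\<^sup>2"
    using sum_squares_bound[of "N (f + g)" "N f"] by simp
  ultimately show ?thesis
    by simp
qed

section \<open>Derivative of the squared norm\<close>

lemma uniformly_frechet_on_norm_differentiable:
  assumes "banach_space_on V N" "uniformly_frechet_on V N" "f \<in> V" "g \<in> V" "f \<noteq> 0"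
  shows "(\<lambda>t::real. N (f + complex_of_real t *\<^sub>C g)) differentiable (at 0)"
proof (cases "g = 0")
  case True
  then have "complex_of_real t *\<^sub>C g = 0" for t
    by simp
  with True show ?thesis
    by simp
next
  case False
  define a b where "a = N f" and "b = N g"
  have a: "a > 0" and b: "b > 0"
    using assms(3-5) False banach_space_on_norm_nonneg[OF assms(1)]
      banach_space_on_norm_eq_zero[OF assms(1)]
    by (simp_all add: a_def b_def order_less_le)
  \<comment> \<open>The limit is available only on the unit sphere, so both vectors are normalized.
    By homogeneity the original function is \<open>a * \<phi> (t * (b / a))\<close>, and the chain
    rule carries the derivative over.\<close>
  define u v where "u = complex_of_real (1 / a) *\<^sub>C f" and "v = complex_of_real (1 / b) *\<^sub>C g"
  have V: "u \<in> V" "v \<in> V"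
    using assms unfolding u_def v_def by (simp_all add: banach_space_on_scale)
  have sphere: "(u, v) \<in> unit_sphere_on V N \<times> unit_sphere_on V N"
    using V a b assms banach_space_on_norm_scale[OF assms(1)]
    by (auto simp: unit_sphere_on_def u_def v_def a_def b_def norm_divide)
  define \<phi> where "\<phi> = (\<lambda>t::real. N (u + complex_of_real t *\<^sub>C v))"
  obtain D where "uniform_limit (unit_sphere_on V N \<times> unit_sphere_on V N)
      (\<lambda>(t::real) (f, g). (N (f + complex_of_real t *\<^sub>C g) - N f) / t) D (at 0)"
    using assms(2) unfolding uniformly_frechet_on_def by blast
  from tendsto_uniform_limitI[OF this sphere]
  have "((\<lambda>t. (\<phi> t - \<phi> 0) / t) \<longlongrightarrow> D (u, v)) (at 0)"
    by (simp add: \<phi>_def)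
  then have \<phi>: "(\<phi> has_real_derivative D (u, v)) (at 0)"
    by (simp add: DERIV_def)
  have "N (f + complex_of_real t *\<^sub>C g) = a * \<phi> (t * (b / a))" for t
  proof -
    have "f + complex_of_real t *\<^sub>C g
        = complex_of_real a *\<^sub>C (u + complex_of_real (t * (b / a)) *\<^sub>C v)"
      using a b by (simp add: u_def v_def scaleC_add_right scaleC_scaleC scaleC_one)
    then show ?thesis
      using V a assms(1) banach_space_on_norm_scale[OF assms(1)]
      by (simp add: \<phi>_def banach_space_on_add banach_space_on_scale del: of_real_mult of_real_divide)
  qed
  moreover have "((\<lambda>t. a * \<phi> (t * (b / a))) has_real_derivative a * (D (u, v) * (b / a))) (at 0)"
    using a by (intro DERIV_cmult DERIV_chain'[where g = \<phi>])
      (auto intro!: derivative_eq_intros simp: \<phi>)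
  ultimately show ?thesis
    by (auto simp: real_differentiable_def)
qed

text \<open>By \<open>sip_subgradient\<close> the squared norm along \<open>g\<close> minus its
  presumed linear part is minimal at \<open>t = 0\<close>. Once the squared norm is known to be
  differentiable there, the derivative of this difference must vanish.\<close>

lemma sip_derivative:
  assumes "uniform_banach_on V N" "compatible_sip_on V N s" "f \<in> V" "g \<in> V"
  shows "((\<lambda>t::real. (N (f + complex_of_real t *\<^sub>C g))\<^sup>2) has_real_derivative 2 * Re (s g f)) (at 0)"
proof -
  let ?F = "\<lambda>t::real. (N (f + complex_of_real t *\<^sub>C g))\<^sup>2"
  have ban: "banach_space_on V N" and fre: "uniformly_frechet_on V N"
    using assms(1) by (simp_all add: uniform_banach_on_def)
  obtain D where D: "(?F has_real_derivative D) (at 0)"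
  proof (cases "f = 0")
    \<comment> \<open>At the origin the norm itself has a kink in nonzero directions, but its square
      along \<open>g\<close> is a quadratic in \<open>t\<close>.\<close>
    case True
    then have "?F t = t\<^sup>2 * (N g)\<^sup>2" for t
      using banach_space_on_norm_scale[OF ban assms(4)] by (simp add: power_mult_distrib)
    then show thesis
      by (intro that[of 0]) (auto intro!: derivative_eq_intros)
  next
    case False
    from uniformly_frechet_on_norm_differentiable[OF ban fre assms(3,4) this]
    obtain E where "((\<lambda>t. N (f + complex_of_real t *\<^sub>C g)) has_real_derivative E) (at 0)"
      by (auto simp: real_differentiable_def)
    from DERIV_power[OF this, of 2] show thesis
      by (rule that)
  qed
  have "((\<lambda>t. ?F t - t * (2 * Re (s g f))) has_real_derivative D - 2 * Re (s g f)) (at 0)"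
    using DERIV_diff[OF D DERIV_cmult_right[OF DERIV_ident]] by simp
  moreover have "?F 0 - 0 * (2 * Re (s g f)) \<le> ?F t - t * (2 * Re (s g f))" for t
    using sip_subgradient[OF ban assms(2,3), of "complex_of_real t *\<^sub>C g"] assms ban
    by (simp add: banach_space_on_scale sip_scale_left)
  ultimately have "D - 2 * Re (s g f) = 0"
    by (intro DERIV_local_min[where d = 1]) auto
  with D show ?thesis
    by simp
qed

section \<open>Strict convexity and uniqueness of the minimizer\<close>

lemma uniformly_convex_on_midpoint_eq:
  assumes "banach_space_on V N" "uniformly_convex_on V N" "f \<in> V" "g \<in> V"
    and "N f = r" "N g = r" "N (f + g) = 2 * r"
  shows "f = g"
proof (rule ccontr)
  assume "f \<noteq> g"
  have d: "f - g \<in> V"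
    using assms by (simp add: banach_space_on_diff)
  have "r \<noteq> 0"
    using \<open>f \<noteq> g\<close> assms banach_space_on_norm_eq_zero[OF assms(1)] by metis
  then have r: "r > 0"
    using assms banach_space_on_norm_nonneg[OF assms(1)] by (metis order_less_le)
  \<comment> \<open>Scaling by \<open>1 / r\<close> puts both vectors on the unit sphere at distance
    \<open>N (f - g) / r\<close>, which serves as \<epsilon>. Their sum has norm 2, against the
    bound \<open>2 - \<delta>\<close>.\<close>
  define c where "c = complex_of_real (1 / r)"
  have scale: "N (c *\<^sub>C h) = N h / r" if "h \<in> V" for h
    using that r banach_space_on_norm_scale[OF assms(1)] by (simp add: c_def norm_divide)
  have "N (f - g) > 0"
    using \<open>f \<noteq> g\<close> d banach_space_on_norm_nonneg[OF assms(1)] banach_space_on_norm_eq_zero[OF assms(1)]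
    by (metis eq_iff_diff_eq_0 order_less_le)
  then have "N (f - g) / r > 0"
    using r by simp
  then obtain \<delta> where "\<delta> > 0" and \<delta>: "\<And>f' g'. f' \<in> V \<Longrightarrow> g' \<in> V \<Longrightarrow> N f' = 1 \<Longrightarrow> N g' = 1 \<Longrightarrow>
      N (f' - g') \<ge> N (f - g) / r \<Longrightarrow> N (f' + g') \<le> 2 - \<delta>"
    using assms(2) unfolding uniformly_convex_on_def by metis
  have sub: "c *\<^sub>C f - c *\<^sub>C g = c *\<^sub>C (f - g)"
    by (simp add: complex_vector.scale_right_diff_distrib)
  have "N (c *\<^sub>C f + c *\<^sub>C g) \<le> 2 - \<delta>"
    using assms r d by (intro \<delta>) (simp_all add: banach_space_on_scale scale sub)
  moreover have "N (c *\<^sub>C f + c *\<^sub>C g) = 2"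
    using assms r by (simp add: scale banach_space_on_add scaleC_add_right[symmetric])
  ultimately show False
    using \<open>\<delta> > 0\<close> by simp
qed

text \<open>If the inequality fails, the triangle inequality forces
  \<open>(N f - N g)\<^sup>2 \<le> 0\<close>. Then the norms agree and
  \<open>N (f + g) = 2 * N f\<close>, which uniform convexity allows only for equal vectors.\<close>

lemma uniform_banach_on_strictly_convex:
  assumes "banach_space_on V N" "uniformly_convex_on V N" "f \<in> V" "g \<in> V" "f \<noteq> g"
  shows "2 * (N ((1/2) *\<^sub>C (f + g)))\<^sup>2 < (N f)\<^sup>2 + (N g)\<^sup>2"
proof (rule ccontr)
  let ?p = "N (f + g)"
  assume "\<not> ?thesis"
  moreover have "N ((1/2) *\<^sub>C (f + g)) = ?p / 2"
    using assms by (simp add: banach_space_on_norm_scale[OF assms(1)] banach_space_on_add)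
  ultimately have ge: "2 * ((N f)\<^sup>2 + (N g)\<^sup>2) \<le> ?p\<^sup>2"
    by (simp add: power_divide)
  have tri: "?p \<le> N f + N g" and nn: "0 \<le> ?p" "0 \<le> N f" "0 \<le> N g"
    using assms by (simp_all add: banach_space_on_norm_triangle banach_space_on_norm_nonneg
        banach_space_on_add)
  have le: "?p\<^sup>2 \<le> (N f + N g)\<^sup>2"
    using tri nn by (intro power_mono)
  then have "(N f - N g)\<^sup>2 \<le> 0"
    using ge by (simp add: power2_eq_square algebra_simps)
  then have eq: "N f = N g"
    by simp
  then have "(2 * N f)\<^sup>2 \<le> ?p\<^sup>2"
    using ge by (simp add: power_mult_distrib)
  then have "2 * N f \<le> ?p"
    using nn(1) by (rule power2_le_imp_le)
  then have "?p = 2 * N f"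
    using tri eq by simp
  then show False
    using uniformly_convex_on_midpoint_eq[OF assms(1-4)] eq assms(5) by metis
qed

text \<open>Convexity of each data term. Strictness is left to the regularizer.\<close>

lemma norm_midpoint_sq_le:
  fixes u v w :: "'a::complex_banach"
  shows "2 * (norm ((1/2) *\<^sub>C (u + v) - w))\<^sup>2 \<le> (norm (u - w))\<^sup>2 + (norm (v - w))\<^sup>2"
proof -
  have "(1/2) *\<^sub>C (u + v) - w = (1/2) *\<^sub>R ((u - w) + (v - w))"
    by (simp add: scaleR_scaleC[of "1/2", simplified, symmetric] algebra_simps flip: scaleR_add_left)
  then have "2 * norm ((1/2) *\<^sub>C (u + v) - w) \<le> norm (u - w) + norm (v - w)"
    using norm_triangle_ineq[of "u - w" "v - w"] by simp
  then have "(2 * norm ((1/2) *\<^sub>C (u + v) - w))\<^sup>2 \<le> (norm (u - w) + norm (v - w))\<^sup>2"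
    by (intro power_mono) auto
  moreover have "0 \<le> (norm (u - w) - norm (v - w))\<^sup>2"
    by simp
  ultimately show ?thesis
    by (simp add: power2_eq_square algebra_simps)
qed

text \<open>The midpoint of two distinct minimizers would have smaller error: the data terms are
  convex and the regularizer, with positive weight, is strictly convex.\<close>

lemma regularized_error_arg_min_unique:
  assumes "uniform_banach_on B N" "reg > 0"
    and f: "is_arg_min (regularized_error N m x \<xi> reg) (\<lambda>f. f \<in> B) f"
    and g: "is_arg_min (regularized_error N m x \<xi> reg) (\<lambda>f. f \<in> B) g"
  shows "f = g"
proof (rule ccontr)
  assume "f \<noteq> g"
  let ?E = "regularized_error N m x \<xi> reg"
  let ?h = "(1/2) *\<^sub>C (f + g)"
  have ban: "banach_space_on B N" and uc: "uniformly_convex_on B N"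
    using assms(1) by (simp_all add: uniform_banach_on_def)
  have B: "f \<in> B" "g \<in> B" and h: "?h \<in> B"
    using f g ban by (auto simp: is_arg_min_def banach_space_on_add banach_space_on_scale)
  have "reg * (2 * (N ?h)\<^sup>2) < reg * ((N f)\<^sup>2 + (N g)\<^sup>2)"
    using uniform_banach_on_strictly_convex[OF ban uc B \<open>f \<noteq> g\<close>] \<open>reg > 0\<close> by simp
  moreover have "(\<Sum>j=1..m. 2 * (norm (?h (x j) - \<xi> j))\<^sup>2)
      \<le> (\<Sum>j=1..m. (norm (f (x j) - \<xi> j))\<^sup>2 + (norm (g (x j) - \<xi> j))\<^sup>2)"
    by (intro sum_mono) (simp add: scaleC_fun_def norm_midpoint_sq_le)
  ultimately have "2 * ?E ?h < ?E f + ?E g"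
    by (simp add: regularized_error_def sum.distrib sum_distrib_left[symmetric] algebra_simps)
  moreover have "?E f \<le> ?E ?h" "?E g \<le> ?E ?h"
    using f g h by (auto simp: is_arg_min_def not_less)
  ultimately show False
    by simp
qed

section \<open>First-order characterization of minimizers\<close>

lemma regularized_error_arg_min_iff:
  assumes L: "uniform_banach_on (UNIV :: 'l::complex_banach set) norm"
    and B: "uniform_banach_on B N"
    and sB: "compatible_sip_on B N sB"
    and sL: "compatible_sip_on (UNIV :: 'l set) norm sL"
    and "reg > 0" "f0 \<in> B"
  shows "is_arg_min (regularized_error N m x \<xi> reg) (\<lambda>f. f \<in> B) f0 \<longleftrightarrow>
    (\<forall>g\<in>B. complex_of_real reg * sB g f0 + (\<Sum>j=1..m. sL (g (x j)) (f0 (x j) - \<xi> j)) = 0)"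
    (is "?min \<longleftrightarrow> (\<forall>g\<in>B. ?G g = 0)")
proof -
  let ?E = "regularized_error N m x \<xi> reg"
  have banL: "banach_space_on (UNIV :: 'l set) norm" and banB: "banach_space_on B N"
    using L B by (simp_all add: uniform_banach_on_def)
  show ?thesis
  proof
    assume min: ?min
    \<comment> \<open>Along \<open>f0 + t g\<close> the error has derivative
      \<open>2 * Re (?G g)\<close> at its minimum \<open>t = 0\<close>.\<close>
    have Re0: "Re (?G g) = 0" if g: "g \<in> B" for g
    proof -
      have "((\<lambda>t. (norm ((f0 (x j) - \<xi> j) + complex_of_real t *\<^sub>C g (x j)))\<^sup>2) has_real_derivative
          2 * Re (sL (g (x j)) (f0 (x j) - \<xi> j))) (at 0)" for j
        by (rule sip_derivative[OF L sL]) auto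
      then have "((\<lambda>t. (norm ((f0 + complex_of_real t *\<^sub>C g) (x j) - \<xi> j))\<^sup>2) has_real_derivative
          2 * Re (sL (g (x j)) (f0 (x j) - \<xi> j))) (at 0)" for j
        by (simp add: scaleC_fun_def algebra_simps)
      then have "((\<lambda>t. ?E (f0 + complex_of_real t *\<^sub>C g)) has_real_derivative
          (\<Sum>j=1..m. 2 * Re (sL (g (x j)) (f0 (x j) - \<xi> j))) + reg * (2 * Re (sB g f0))) (at 0)"
        unfolding regularized_error_def
        by (intro DERIV_add DERIV_sum DERIV_cmult sip_derivative[OF B sB \<open>f0 \<in> B\<close> g])
      moreover have "?E (f0 + complex_of_real 0 *\<^sub>C g) \<le> ?E (f0 + complex_of_real t *\<^sub>C g)" for t
        using min g banB \<open>f0 \<in> B\<close>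
        by (auto simp: is_arg_min_def not_less banach_space_on_add banach_space_on_scale)
      ultimately have "(\<Sum>j=1..m. 2 * Re (sL (g (x j)) (f0 (x j) - \<xi> j))) + reg * (2 * Re (sB g f0)) = 0"
        by (intro DERIV_local_min[where d = 1]) auto
      then show ?thesis
        by (simp add: sum_distrib_left[symmetric])
    qed
    show "\<forall>g\<in>B. ?G g = 0"
    proof
      fix g assume g: "g \<in> B"
      have "sB (\<i> *\<^sub>C g) f0 = \<i> * sB g f0"
        using sip_scale_left[OF sB g \<open>f0 \<in> B\<close>] .
      moreover have "sL ((\<i> *\<^sub>C g) (x j)) (f0 (x j) - \<xi> j) = \<i> * sL (g (x j)) (f0 (x j) - \<xi> j)" for j
        using sip_scale_left[OF sL] by (simp add: scaleC_fun_def)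
      ultimately have "?G (\<i> *\<^sub>C g) = \<i> * ?G g"
        by (simp add: sum_distrib_left algebra_simps)
      then have "Re (\<i> * ?G g) = 0"
        using Re0[OF banach_space_on_scale[OF banB g]] by metis
      then have "Im (?G g) = 0"
        by (simp only: Re_i_times neg_equal_0_iff_equal)
      with Re0[OF g] show "?G g = 0"
        by (simp add: complex_eq_iff)
    qed
  next
    assume G: "\<forall>g\<in>B. ?G g = 0"
    \<comment> \<open>The subgradient inequalities at \<open>f0\<close> and at each residual are
      added, the former with weight \<open>reg\<close>. Their linear terms sum to
      \<open>2 * Re (?G g)\<close>, which is zero.\<close>
    have "?E f0 \<le> ?E f" if f: "f \<in> B" for f
    proof -
      define g where "g = f - f0"
      have g: "g \<in> B" and fg: "f = f0 + g"
        using f \<open>f0 \<in> B\<close> banB by (simp_all add: g_def banach_space_on_diff)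
      have "Re (?G g) = 0"
        using G g by simp
      then have "(\<Sum>j=1..m. 2 * Re (sL (g (x j)) (f0 (x j) - \<xi> j))) + reg * (2 * Re (sB g f0)) = 0"
        by (simp add: sum_distrib_left[symmetric])
      moreover have "(\<Sum>j=1..m. (norm (f0 (x j) - \<xi> j))\<^sup>2 + 2 * Re (sL (g (x j)) (f0 (x j) - \<xi> j)))
          \<le> (\<Sum>j=1..m. (norm (f (x j) - \<xi> j))\<^sup>2)"
      proof (rule sum_mono)
        fix j
        have "f0 (x j) - \<xi> j + g (x j) = f (x j) - \<xi> j"
          by (simp add: fg)
        then show "(norm (f0 (x j) - \<xi> j))\<^sup>2 + 2 * Re (sL (g (x j)) (f0 (x j) - \<xi> j))
            \<le> (norm (f (x j) - \<xi> j))\<^sup>2"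
          using sip_subgradient[OF banL sL, of "f0 (x j) - \<xi> j" "g (x j)"] by (simp only: UNIV_I)
      qed
      moreover have "reg * ((N f0)\<^sup>2 + 2 * Re (sB g f0)) \<le> reg * (N f)\<^sup>2"
        using sip_subgradient[OF banB sB \<open>f0 \<in> B\<close> g] \<open>reg > 0\<close> by (simp add: fg)
      ultimately show ?thesis
        by (simp add: regularized_error_def sum.distrib distrib_left)
    qed
    then show ?min
      using \<open>f0 \<in> B\<close> by (auto simp: is_arg_min_def not_less)
  qed
qed

section \<open>Translation into dual functionals\<close>

lemma sum_fun_apply: "(\<Sum>j\<in>A. F j) y = (\<Sum>j\<in>A. F j y)"
  by (induction A rule: infinite_finite_induct) auto

theorem corollary5p9:
  fixes B :: "('x \<Rightarrow> 'l::complex_banach) set"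
    and N :: "('x \<Rightarrow> 'l) \<Rightarrow> real"
    and sB :: "('x \<Rightarrow> 'l) \<Rightarrow> ('x \<Rightarrow> 'l) \<Rightarrow> complex"
    and sL :: "'l \<Rightarrow> 'l \<Rightarrow> complex"
    and K :: "'x \<Rightarrow> 'x \<Rightarrow> 'l \<Rightarrow> 'l"
    and m :: nat and x :: "nat \<Rightarrow> 'x" and \<xi> :: "nat \<Rightarrow> 'l" and reg :: real
    and f0 :: "'x \<Rightarrow> 'l"
  assumes "rkbs B N"
    and "compatible_sip_on B N sB"
    and "compatible_sip_on UNIV norm sL"
    and "reproducing_kernel B sB sL K"
    and "reg > 0"
    and "essentially_independent_evals B sL m x"
    and "f0 \<in> B"
  shows "(\<exists>\<^sub>\<le>\<^sub>1 f. is_arg_min (regularized_error N m x \<xi> reg) (\<lambda>f. f \<in> B) f) \<and>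
    (is_arg_min (regularized_error N m x \<xi> reg) (\<lambda>f. f \<in> B) f0 \<longleftrightarrow>
      (\<exists>\<eta> :: nat \<Rightarrow> 'l.
        sip_dual B sB f0 = (\<Sum>j=1..m. sip_dual B sB (\<lambda>y. K (x j) y (\<eta> j))) \<and>
        (\<forall>j\<in>{1..m}. reg *\<^sub>R \<eta> j + f0 (x j) - \<xi> j = 0)))"
proof -
  have L: "uniform_banach_on (UNIV :: 'l set) norm" and B: "uniform_banach_on B N"
    using assms(1) by (simp_all add: rkbs_def)
  \<comment> \<open>Outside \<open>B\<close> both sides are 0 by the default value in
    \<open>sip_dual\<close>. On \<open>B\<close> the reproducing property evaluates the kernel
    terms.\<close>
  have dual: "sip_dual B sB f0 = (\<Sum>j=1..m. sip_dual B sB (\<lambda>y. K (x j) y (\<eta> j))) \<longleftrightarrow>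
      (\<forall>g\<in>B. sB g f0 = (\<Sum>j=1..m. sL (g (x j)) (\<eta> j)))" for \<eta>
    using assms(4)
    by (auto simp: fun_eq_iff sum_fun_apply sip_dual_def reproducing_kernel_def)
  have residual: "(\<forall>g\<in>B. sB g f0 = (\<Sum>j=1..m. sL (g (x j)) (\<eta> j))) \<longleftrightarrow>
      (\<forall>g\<in>B. complex_of_real reg * sB g f0 + (\<Sum>j=1..m. sL (g (x j)) (f0 (x j) - \<xi> j)) = 0)"
    if \<eta>: "\<forall>j\<in>{1..m}. reg *\<^sub>R \<eta> j + f0 (x j) - \<xi> j = 0" for \<eta>
  proof -
    \<comment> \<open>The residual is \<open>- reg\<close> times \<open>\<eta> j\<close>, and
      conjugation leaves this real factor unchanged. The stationarity expression thus becomes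
      \<open>reg\<close> times the difference of the two sides, and \<open>reg\<close> is
      nonzero.\<close>
    have "sL u (f0 (x j) - \<xi> j) = - complex_of_real reg * sL u (\<eta> j)" if "j \<in> {1..m}" for u j
    proof -
      have "f0 (x j) - \<xi> j = - (reg *\<^sub>R \<eta> j)"
        using \<eta> that by (simp add: eq_neg_iff_add_eq_0 algebra_simps)
      also have "\<dots> = complex_of_real (- reg) *\<^sub>C \<eta> j"
        by (simp flip: scaleR_scaleC scaleR_minus_left)
      finally show ?thesis
        using sip_scale_right[OF assms(3), of u "\<eta> j" "complex_of_real (- reg)"] by simp
    qed
    then have "(\<Sum>j=1..m. sL (g (x j)) (f0 (x j) - \<xi> j))
        = - complex_of_real reg * (\<Sum>j=1..m. sL (g (x j)) (\<eta> j))" for g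
      by (simp add: sum_distrib_left)
    then show ?thesis
      using \<open>reg > 0\<close> by simp
  qed
  \<comment> \<open>The second condition can always be solved for the coefficients. This solution is
    the witness when the stationarity condition is given.\<close>
  have "\<forall>j\<in>{1..m}. reg *\<^sub>R ((1 / reg) *\<^sub>R (\<xi> j - f0 (x j))) + f0 (x j) - \<xi> j = 0"
    using \<open>reg > 0\<close> by simp
  then obtain \<eta>\<^sub>0 where \<eta>\<^sub>0: "\<forall>j\<in>{1..m}. reg *\<^sub>R \<eta>\<^sub>0 j + f0 (x j) - \<xi> j = 0"
    by (rule that)
  let ?stat = "\<forall>g\<in>B. complex_of_real reg * sB g f0 + (\<Sum>j=1..m. sL (g (x j)) (f0 (x j) - \<xi> j)) = 0"
  have "is_arg_min (regularized_error N m x \<xi> reg) (\<lambda>f. f \<in> B) f0 \<longleftrightarrow> ?stat"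
    by (rule regularized_error_arg_min_iff[OF L B assms(2,3,5,7)])
  also have "\<dots> \<longleftrightarrow>
      (\<exists>\<eta>. sip_dual B sB f0 = (\<Sum>j=1..m. sip_dual B sB (\<lambda>y. K (x j) y (\<eta> j))) \<and>
        (\<forall>j\<in>{1..m}. reg *\<^sub>R \<eta> j + f0 (x j) - \<xi> j = 0))" (is "_ \<longleftrightarrow> ?form")
  proof
    assume ?stat
    then show ?form
      using \<eta>\<^sub>0 by (intro exI[of _ \<eta>\<^sub>0] conjI) (simp_all only: dual residual[OF \<eta>\<^sub>0])
  next
    assume ?form
    then obtain \<eta> where "\<forall>g\<in>B. sB g f0 = (\<Sum>j=1..m. sL (g (x j)) (\<eta> j))"
      and \<eta>: "\<forall>j\<in>{1..m}. reg *\<^sub>R \<eta> j + f0 (x j) - \<xi> j = 0"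
      unfolding dual by blast
    then show ?stat
      by (simp only: residual[OF \<eta>])
  qed
  finally have "is_arg_min (regularized_error N m x \<xi> reg) (\<lambda>f. f \<in> B) f0 \<longleftrightarrow> ?form" .
  \<comment> \<open>Since \<open>is_arg_min\<close> alone admits several minimizers, this conjunct
    makes \<open>f0\<close> the minimizer rather than a minimizer.\<close>
  moreover have "\<exists>\<^sub>\<le>\<^sub>1 f. is_arg_min (regularized_error N m x \<xi> reg) (\<lambda>f. f \<in> B) f"
    using regularized_error_arg_min_unique[OF B assms(5)] by (intro Uniq_I)
  ultimately show ?thesis
    by blast
qed

end
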